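(* Let $F$ be a field and let $R$ be the ring of $\mathbb{Z}\times\mathbb{Z}$ matrices over $F$ defined in the context. Then $R$ is unit-regular.
   Context: Rings are associative with $1$, not necessarily commutative. An element $a$ of a ring $R$ is unit-regular if there is a unit $u\in R$ with $aua=a$; a ring is unit-regular if each of its elements is unit-regular. Definition of $R$: let $F$ be a field and let $F(\!(t)\!)$ be the field of formal Laurent series over $F$. $R$ is the set of all $\mathbb{Z}\times\mathbb{Z}$ matrices $A=(a_{i,j})_{i,j\in\mathbb{Z}}$ over $F$ for which there exist $m,n\in\mathbb{Z}$ and $f(t)=\sum_{k=k_0}^{\infty}c_kt^k\in F(\!(t)\!)$ such that (i) if $i\geq m$ or $j<n$, then $a_{i,j}=c_{j-i}$ (where $c_k:=0$ for $k<k_0$); and (ii) the submatrix $(a_{i,j})_{i<m,\,j\geq n}$ has finite rank (i.e. it has only finitely many linearly independent columns, equivalently only finitely many linearly independent rows). With the usual matrix addition and multiplication (rows of elements of $R$ are bounded from the left and columns are bounded from below, so the sums defining the products are finite), $R$ is a ring with $1$. *)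

theory Defs
  imports
    "HOL-Algebra.Ring"
    "HOL-Library.Function_Algebras"
    "HOL-Library.Groups_Big_Fun"
    "HOL-Computational_Algebra.Formal_Laurent_Series"
begin

definition unit_regular_elem :: "('r, 'm) ring_scheme \<Rightarrow> 'r \<Rightarrow> bool"
  where "unit_regular_elem S a \<longleftrightarrow> (\<exists>u\<in>Units S. a \<otimes>\<^bsub>S\<^esub> u \<otimes>\<^bsub>S\<^esub> a = a)"

definition unit_regular_ring :: "('r, 'm) ring_scheme \<Rightarrow> bool"
  where "unit_regular_ring S \<longleftrightarrow> ring S \<and> (\<forall>a\<in>carrier S. unit_regular_elem S a)"

type_synonym 'a zmatrix = "int \<Rightarrow> int \<Rightarrow> 'a"

definition col_scale :: "'a::field \<Rightarrow> (int \<Rightarrow> 'a) \<Rightarrow> int \<Rightarrow> 'a"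
  where "col_scale c v = (\<lambda>i. c * v i)"

global_interpretation col: vector_space "col_scale :: 'a::field \<Rightarrow> (int \<Rightarrow> 'a) \<Rightarrow> int \<Rightarrow> 'a"
  by unfold_locales (auto simp: col_scale_def fun_eq_iff algebra_simps)

text \<open>The submatrix with rows \<open>i < m\<close> and columns \<open>j \<ge> n\<close>. Its columns are extended
  by zero to all row indices, which does not affect linear independence.\<close>

definition corner_columns :: "int \<Rightarrow> int \<Rightarrow> 'a::field zmatrix \<Rightarrow> (int \<Rightarrow> 'a) set"
  where "corner_columns m n A = {(\<lambda>i. if i < m then A i j else 0) | j. j \<ge> n}"

definition corner_finite_rank :: "int \<Rightarrow> int \<Rightarrow> 'a::field zmatrix \<Rightarrow> bool"
  where "corner_finite_rank m n A \<longleftrightarrow>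
    (\<forall>C \<subseteq> corner_columns m n A. col.independent C \<longrightarrow> finite C)"

definition laurent_zmatrices :: "'a::field zmatrix set"
  where "laurent_zmatrices = {A. \<exists>m n. \<exists>f :: 'a fls.
    (\<forall>i j. i \<ge> m \<or> j < n \<longrightarrow> A i j = fls_nth f (j - i)) \<and> corner_finite_rank m n A}"

text \<open>The multiplication sums over all integers \<open>k\<close> by \<^const>\<open>Sum_any\<close>. This is the
  intended product because only finitely many summands are nonzero when \<open>A\<close> and \<open>B\<close> are in
  the carrier: row \<open>i\<close> of \<open>A\<close> vanishes for small \<open>k\<close> and column \<open>j\<close> of \<open>B\<close> for large \<open>k\<close>.\<close>

definition laurent_zmatrix_ring :: "'a::field zmatrix ring"
  where "laurent_zmatrix_ring = \<lparr>
    carrier = laurent_zmatrices,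
    monoid.mult = (\<lambda>A B i j. Sum_any (\<lambda>k. A i k * B k j)),
    monoid.one = (\<lambda>i j. if i = j then 1 else 0),
    ring.zero = (\<lambda>i j. 0),
    ring.add = (\<lambda>A B i j. A i j + B i j)\<rparr>"

end

(* Modulo finite-rank matrices an element of R is determined by its Laurent series f, and
   f |-> (Toeplitz matrix of f with the corner i < 0 <= j erased) is multiplicative modulo finite
   rank. It is exactly multiplicative on power series and the powers of t lift to honest shifts, so
   every nonzero f = t^s g is the symbol of a unit of R. Multiplying by such a unit reduces the
   claim to matrices 0 + B and 1 + B with B of finite rank. Finally, adding a rank-one matrix x y
   preserves unit-regularity: up to a unit the matrix is p + x y with p idempotent, and explicit
   transvections bring p + x y to an idempotent. *)
theory Submission
  imports Defs
begin

text \<open>Since the quotient by the finite-rank matrices is a field, the danger lies in lifting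
  its units: for matrices indexed by the naturals, a lift of \<open>t\<close> has nonzero Fredholm
  index, and no finite-rank change makes it invertible. Indexing by all integers makes the shift
  invertible and removes this obstruction. The rank-one step treats an arbitrary unit-regular
  element, not merely 0 and 1, because after one perturbation nothing else is known about the
  matrix. No dimension count is involved: invertibility of \<open>1 + w * d\<close> reduces to that
  of \<open>E + d * w\<close>, which plays the role of a scalar.\<close>

section \<open>Rank-one perturbations of unit-regular elements\<close>

text \<open>The model is a full ring of operators with \<open>E\<close> a rank-one projection: the \<open>x\<close> with
  \<open>x * E = x\<close> are vectors, the \<open>y\<close> with \<open>E * y = y\<close> are functionals, and the products \<open>x * y\<close>
  are the operators of rank at most one. Units and regularity are relative to a subring \<open>R\<close>
  containing all of these.\<close>

locale rank_one_ring =
  fixes E :: "'r::ring_1" and R :: "'r set"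
  assumes column_left_inverse: "x * E = x \<Longrightarrow> x \<noteq> 0 \<Longrightarrow> \<exists>z. E * z = z \<and> z * x = E"
    and row_right_inverse: "E * y = y \<Longrightarrow> y \<noteq> 0 \<Longrightarrow> \<exists>w. w * E = w \<and> y * w = E"
    and idem: "E * E = E"
    and one_mem: "1 \<in> R"
    and diff_mem: "a \<in> R \<Longrightarrow> b \<in> R \<Longrightarrow> a - b \<in> R"
    and mult_mem: "a \<in> R \<Longrightarrow> b \<in> R \<Longrightarrow> a * b \<in> R"
    and column_mem: "x * E = x \<Longrightarrow> x \<in> R"
    and row_mem: "E * y = y \<Longrightarrow> y \<in> R"
begin

lemma add_mem: "a \<in> R \<Longrightarrow> b \<in> R \<Longrightarrow> a + b \<in> R"
  using diff_mem[of a "0 - b"] diff_mem[of 0 b] diff_mem[OF one_mem one_mem] by simp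

definition units :: "'r set"
  where "units = {u \<in> R. \<exists>v\<in>R. u * v = 1 \<and> v * u = 1}"

definition ureg :: "'r \<Rightarrow> bool"
  where "ureg a \<longleftrightarrow> (\<exists>u\<in>units. a * u * a = a)"

lemma unitsI: "u \<in> R \<Longrightarrow> v \<in> R \<Longrightarrow> u * v = 1 \<Longrightarrow> v * u = 1 \<Longrightarrow> u \<in> units"
  unfolding units_def by blast

lemma units_mult: assumes "u \<in> units" "v \<in> units" shows "u * v \<in> units"
proof -
  obtain u' v' where *: "u' \<in> R" "v' \<in> R" "u * u' = 1" "u' * u = 1" "v * v' = 1" "v' * v = 1" "u \<in> R" "v \<in> R"
    using assms unfolding units_def by blast
  have "u * v * (v' * u') = u * (v * v') * u'" "v' * u' * (u * v) = v' * (u' * u) * v"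
    by (simp_all only: mult.assoc)
  then show ?thesis
    using * by (intro unitsI[of _ "v' * u'"] mult_mem) simp_all
qed

lemma ureg_idempotent: "p * p = p \<Longrightarrow> ureg p"
  unfolding ureg_def by (intro bexI[of _ 1] unitsI[of _ 1]) (auto simp: one_mem)

lemma ureg_unit_left:
  assumes "u \<in> units" "ureg (u * a)" shows "ureg a"
proof -
  obtain w u' where w: "w \<in> units" "u * a * w * (u * a) = u * a" "u' * u = 1"
    using assms unfolding ureg_def units_def by blast
  have "a * (w * u) * a = (u' * u) * a * (w * u) * a"
    using w by simp
  also have "\<dots> = u' * (u * a * w * (u * a))"
    by (simp only: mult.assoc)
  also have "\<dots> = (u' * u) * a"
    unfolding w(2) by (simp only: mult.assoc)
  finally have "a * (w * u) * a = a" using w by simp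
  then show ?thesis
    unfolding ureg_def using units_mult[OF w(1) assms(1)] by blast
qed

lemma ureg_unit_right:
  assumes "u \<in> units" "ureg (a * u)" shows "ureg a"
proof -
  obtain w u' where w: "w \<in> units" "a * u * w * (a * u) = a * u" "u * u' = 1"
    using assms unfolding ureg_def units_def by blast
  have "a * (u * w) * a = a * (u * w) * a * (u * u')"
    using w by simp
  also have "\<dots> = (a * u * w * (a * u)) * u'"
    by (simp only: mult.assoc)
  also have "\<dots> = a * (u * u')"
    unfolding w(2) by (simp only: mult.assoc)
  finally have "a * (u * w) * a = a" using w by simp
  then show ?thesis
    unfolding ureg_def using units_mult[OF assms(1) w(1)] by blast
qed

lemma one_minus_nilpotent_unit:
  assumes "n \<in> R" "n * n = 0" shows "1 - n \<in> units"
  using assms by (intro unitsI[of _ "1 + n"] diff_mem add_mem one_mem) (auto simp: algebra_simps)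

text \<open>The corner cut out by \<open>E\<close> is a division ring: a nonzero \<open>a\<close> in
  it is at once a column and a row, so it has a left inverse \<open>z\<close> and a right inverse
  \<open>w\<close>, and \<open>z * a * w\<close> shows that they agree once cut down to the
  corner.\<close>

lemma corner_inverse:
  assumes a: "E * a = a" "a * E = a" "a \<noteq> 0"
  obtains k where "k * a = E" "a * k = E" "E * k = k"
proof -
  obtain z w where zw: "E * z = z" "z * a = E" "w * E = w" "a * w = E"
    using column_left_inverse[OF a(2,3)] row_right_inverse[OF a(1,3)] by blast
  have "E * w = z * E"
    using zw by (metis mult.assoc)
  moreover have "a * (E * w) = E" "z * E * a = E"
    using a zw by (simp_all flip: mult.assoc) (simp_all add: mult.assoc a zw)
  ultimately show thesis
    using that[of "E * w"] by (metis idem mult.assoc)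
qed

text \<open>Sherman-Morrison formula: with \<open>k\<close> the inverse of the scalar
  \<open>E + d * w\<close> in the corner, the inverse is \<open>1 - w * k * d\<close>.\<close>

lemma one_plus_rank_one_unit:
  assumes w: "w * E = w" and d: "E * d = d" and nz: "E + d * w \<noteq> 0"
  shows "1 + w * d \<in> units"
proof -
  have "E * (E + d * w) = E + d * w" "(E + d * w) * E = E + d * w"
    using w d idem by (simp_all add: distrib_left distrib_right mult.assoc) (simp flip: mult.assoc)
  then obtain k where k: "k * (E + d * w) = E" "(E + d * w) * k = E" "E * k = k"
    using nz corner_inverse by metis
  have kE: "k * E = k"
    by (metis k mult.assoc)
  have "(1 + w * d) * (1 - w * k * d) = 1 + w * d - (w * E) * k * d - w * d * w * k * d"
    by (simp only: w) (simp add: algebra_simps)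
  also have "\<dots> = 1 + w * d - w * ((E + d * w) * k) * d"
    by (simp add: algebra_simps)
  finally have 1: "(1 + w * d) * (1 - w * k * d) = 1"
    by (simp add: k w)
  have "(1 - w * k * d) * (1 + w * d) = 1 + w * d - w * k * (E * d) - w * k * d * w * d"
    by (simp only: d) (simp add: algebra_simps)
  also have "\<dots> = 1 + w * d - w * (k * (E + d * w)) * d"
    by (simp add: algebra_simps)
  finally have 2: "(1 - w * k * d) * (1 + w * d) = 1"
    by (simp add: k w)
  show ?thesis
    using 1 2 w d k by (intro unitsI[of _ "1 - w * k * d"] diff_mem add_mem one_mem mult_mem)
       (auto intro: column_mem row_mem)
qed

text \<open>A unit fixing \<open>p\<close> and carrying the row \<open>y\<close> to a row \<open>z\<close> with \<open>z * x = E\<close> turns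
  \<open>p + x * y\<close> into the idempotent \<open>p + x * z\<close>.\<close>

lemma ureg_idempotent_plus_orthogonal:
  assumes p: "p * p = p" and x: "x * E = x" "p * x = 0" "x \<noteq> 0" and y: "E * y = y" "y * p = 0"
  shows "ureg (p + x * y)"
proof (cases "y = 0")
  case True
  then show ?thesis using p by (simp add: ureg_idempotent)
next
  case False
  obtain z0 w0 where z0: "E * z0 = z0" "z0 * x = E" and w0: "w0 * E = w0" "y * w0 = E"
    using column_left_inverse[OF x(1,3)] row_right_inverse[OF y(1) False] by blast
  \<comment> \<open>The corrections keep \<open>z * x = E\<close> and \<open>y * w1 = E\<close>,
    because \<open>p * x = 0\<close> and \<open>y * p = 0\<close>, and make \<open>z\<close> and
    \<open>w1\<close> orthogonal to \<open>p\<close>.\<close>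
  define z where "z = z0 - z0 * p"
  define w1 where "w1 = w0 - p * w0"
  have z: "E * z = z" "z * x = E" "z * p = 0"
    using z0 p x by (auto simp: z_def algebra_simps) (simp flip: mult.assoc)
  have w1: "w1 * E = w1" "y * w1 = E" "p * w1 = 0"
    using w0 p y by (auto simp: w1_def algebra_simps) (simp_all flip: mult.assoc)
  have E0: "E \<noteq> 0"
    using x by auto
  \<comment> \<open>As \<open>y * w = E\<close>, the scalar that decides whether
    \<open>1 + w * (z - y)\<close> is a unit is \<open>E + (z - y) * w = z * w\<close>; hence the
    last requirement.\<close>
  obtain w where w: "w * E = w" "y * w = E" "p * w = 0" "z * w \<noteq> 0"
  proof (cases "y * x = 0")
    case True
    \<comment> \<open>Adding \<open>x\<close> changes \<open>z * w1\<close> by \<open>E\<close> and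
      leaves \<open>y * w1\<close> alone, so one of the two candidates works.\<close>
    show ?thesis
      using that[of w1] that[of "w1 + x"] w1 z x True E0
      by (cases "z * w1 = 0") (auto simp: algebra_simps)
  next
    case False
    have "E * (y * x) = y * x" "y * x * E = y * x"
      using x y by (simp_all add: mult.assoc) (simp flip: mult.assoc)
    then obtain k where k: "y * x * k = E" "k * (y * x) = E" "E * k = k"
      using False corner_inverse by metis
    have "k * E = k"
      by (metis k mult.assoc)
    moreover have "z * (x * k) = k"
      using z k by (simp flip: mult.assoc)
    moreover have "k \<noteq> 0"
      using k E0 by auto
    ultimately show ?thesis
      using that[of "x * k"] k x by (auto simp: mult.assoc) (auto simp flip: mult.assoc)
  qed
  have "1 + w * (z - y) \<in> units"
    using w z y by (intro one_plus_rank_one_unit) (auto simp: algebra_simps)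
  moreover have "(p + x * y) * (1 + w * (z - y)) = p + x * y + (p * w) * (z - y) + x * (y * w) * (z - y)"
    by (simp add: algebra_simps)
  then have "(p + x * y) * (1 + w * (z - y)) = p + x * z"
    using w x by (simp add: algebra_simps)
  moreover have "(p + x * z) * (p + x * z) = p * p + (p * x) * z + x * (z * p) + x * (z * x) * z"
    by (simp add: algebra_simps)
  then have "(p + x * z) * (p + x * z) = p + x * z"
    by (simp add: p x z)
  ultimately show ?thesis
    by (metis ureg_unit_right ureg_idempotent)
qed

text \<open>The parts \<open>x1\<close> and \<open>y1\<close> of \<open>x\<close> and
  \<open>y\<close> outside \<open>p\<close> decide. A nonzero \<open>x1\<close> admits a functional
  that clears \<open>p * x\<close>, which leads to the orthogonal case; if only \<open>y1\<close> is
  nonzero, all of \<open>x * y\<close> can be cleared from the right.\<close>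

lemma ureg_idempotent_plus_rank_one:
  assumes pR: "p \<in> R" and p: "p * p = p" and x: "x * E = x" and y: "E * y = y"
  shows "ureg (p + x * y)"
proof -
  define x1 where "x1 = x - p * x"
  define y1 where "y1 = y - y * p"
  have x1: "x1 * E = x1" "p * x1 = 0" and y1: "E * y1 = y1" "y1 * p = 0"
    using x y p by (auto simp: x1_def y1_def algebra_simps) (simp_all flip: mult.assoc)
  note mem = mult_mem diff_mem pR column_mem[OF x] row_mem[OF y] column_mem[OF x1(1)] row_mem[OF y1(1)]
  consider "x1 \<noteq> 0" | "x1 = 0" "y1 \<noteq> 0" | "x1 = 0" "y1 = 0" by blast
  then show ?thesis
  proof cases
    case 1
    obtain z0 where z0: "E * z0 = z0" "z0 * x1 = E"
      using column_left_inverse[OF x1(1) 1] by blast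
    \<comment> \<open>The correction gives \<open>z * p = 0\<close>, so that
      \<open>z * x = z * x1 = E\<close> and \<open>p * x * z\<close> squares to zero.\<close>
    define z where "z = z0 - z0 * p"
    have z: "E * z = z" "z * p = 0"
      using z0 p by (auto simp: z_def algebra_simps) (simp flip: mult.assoc)
    have "z * x1 = E"
      using z0 x1 by (simp add: z_def algebra_simps)
    moreover have "z * x1 = z * x - (z * p) * x"
      by (simp add: x1_def algebra_simps)
    ultimately have zx: "z * x = E" using z by simp
    have "p * x * z * (p * x * z) = p * x * (z * p) * x * z"
      by (simp add: mult.assoc)
    then have u1: "1 - p * x * z \<in> units"
      using z by (intro one_minus_nilpotent_unit mem) (auto intro: row_mem)
    have "x1 * y * p * (x1 * y * p) = x1 * y * (p * x1) * y * p"
      by (simp add: mult.assoc)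
    then have u2: "1 - x1 * y * p \<in> units"
      using x1 by (intro one_minus_nilpotent_unit mem) simp
    have "(1 - p * x * z) * (p + x * y) = p + x * y - p * x * (z * p) - p * (x * (z * x)) * y"
      by (simp add: algebra_simps)
    then have e1: "(1 - p * x * z) * (p + x * y) = p + x1 * y"
      by (simp add: z zx x x1_def algebra_simps)
    have "(1 - x1 * y * p) * (p + x1 * y) = p + x1 * y - x1 * y * (p * p) - x1 * y * (p * x1) * y"
      by (simp add: algebra_simps)
    then have e2: "(1 - x1 * y * p) * (p + x1 * y) = p + x1 * y1"
      by (simp add: p x1 y1_def algebra_simps)
    show ?thesis
      using ureg_idempotent_plus_orthogonal[OF p x1 1 y1] e1 e2 u1 u2 ureg_unit_left by metis
  next
    case 2
    obtain w0 where w0: "w0 * E = w0" "y1 * w0 = E"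
      using row_right_inverse[OF y1(1) 2(2)] by blast
    define w where "w = w0 - p * w0"
    have w: "w * E = w" "p * w = 0"
      using w0 p by (auto simp: w_def algebra_simps) (simp flip: mult.assoc)
    have "y1 * w = y1 * w0 - (y1 * p) * w0" "y1 * w = y * w - y * (p * w)"
      by (simp_all add: w_def y1_def algebra_simps)
    then have yw: "y * w = E" using w w0 y1 by simp
    have px: "p * x = x" using 2 by (simp add: x1_def)
    have y1x: "y1 * x = 0"
      by (metis px y1(2) mult.assoc mult_zero_left)
    have "w * y * p * (w * y * p) = w * y * (p * w) * y * p"
      by (simp add: mult.assoc)
    then have u1: "1 - w * y * p \<in> units"
      using w by (intro one_minus_nilpotent_unit mem) (auto intro: column_mem)
    have "x * y1 * (x * y1) = x * (y1 * x) * y1"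
      by (simp add: mult.assoc)
    then have u2: "1 - x * y1 \<in> units"
      using y1x by (intro one_minus_nilpotent_unit mem) simp
    have "(p + x * y) * (1 - w * y * p) = p + x * y - (p * w) * y * p - x * (y * w) * y * p"
      by (simp add: algebra_simps)
    then have e1: "(p + x * y) * (1 - w * y * p) = p + x * y1"
      by (simp add: w yw x y1_def algebra_simps)
    have "(p + x * y1) * (1 - x * y1) = p + x * y1 - (p * x) * y1 - x * (y1 * x) * y1"
      by (simp add: algebra_simps)
    then have e2: "(p + x * y1) * (1 - x * y1) = p"
      by (simp add: px y1x)
    show ?thesis
      using ureg_idempotent[OF p] e1 e2 u1 u2 ureg_unit_right by metis
  next
    case 3
    then have px: "p * x = x" and yp: "y * p = y"
      by (simp_all add: x1_def y1_def)
    \<comment> \<open>Here the sum is \<open>p * (1 + x * y)\<close>, and \<open>E + y * x\<close>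
      acts as the determinant of the second factor. If it vanishes,
      \<open>x * (y * x) * y = - (x * y)\<close> makes the sum idempotent.\<close>
    show ?thesis
    proof (cases "E + y * x = 0")
      case True
      then have "y * x = - E" by (simp add: eq_neg_iff_add_eq_0 add.commute)
      moreover have "(p + x * y) * (p + x * y) = p * p + (p * x) * y + x * (y * p) + x * (y * x) * y"
        by (simp add: algebra_simps)
      ultimately show ?thesis
        using p px yp x by (intro ureg_idempotent) simp
    next
      case False
      then have "1 + x * y \<in> units"
        by (rule one_plus_rank_one_unit[OF x y])
      then obtain v where v: "v \<in> units" "(1 + x * y) * v = 1"
        unfolding units_def by blast
      have "p + x * y = p * (1 + x * y)"
        using px by (simp add: distrib_left flip: mult.assoc)
      then have "(p + x * y) * v = p"
        using v by (simp add: mult.assoc)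
      then show ?thesis
        using ureg_idempotent[OF p] v ureg_unit_right by metis
    qed
  qed
qed

text \<open>For a unit \<open>u\<close> with \<open>a * u * a = a\<close> the product
  \<open>a * u\<close> is idempotent, and in the rank-one term multiplication by \<open>u\<close>
  only changes the row \<open>y\<close> to \<open>y * u\<close>.\<close>

lemma ureg_plus_rank_one:
  assumes "a \<in> R" "ureg a" and x: "x * E = x" and y: "E * y = y"
  shows "ureg (a + x * y)"
proof -
  obtain u where u: "u \<in> units" "a * u * a = a"
    using assms(2) unfolding ureg_def by blast
  have "ureg (a * u + x * (y * u))"
  proof (rule ureg_idempotent_plus_rank_one)
    show "a * u * (a * u) = a * u"
      using u by (simp flip: mult.assoc)
    show "E * (y * u) = y * u"
      using y by (simp flip: mult.assoc)
  qed (use x assms u in \<open>auto intro: mult_mem simp: units_def\<close>)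
  then show ?thesis
    using ureg_unit_right[OF u(1), of "a + x * y"] by (simp add: distrib_right mult.assoc)
qed

end

section \<open>The ideal of finite-rank elements\<close>

text \<open>Built from rank-one terms, so that a perturbation is absorbed one term at a time. It is
  an ideal of the whole ambient ring, not only of \<open>R\<close>; factors such as
  \<open>toeplitz f\<close> and \<open>proj S\<close> may lie outside \<open>R\<close>.\<close>

inductive_set finite_rank :: "'r::ring_1 \<Rightarrow> 'r set" for E where
  zero: "0 \<in> finite_rank E"
| add_rank_one: "a \<in> finite_rank E \<Longrightarrow> x * E = x \<Longrightarrow> E * y = y \<Longrightarrow> a + x * y \<in> finite_rank E"

lemma finite_rank_rank_one: "x * E = x \<Longrightarrow> E * y = y \<Longrightarrow> x * y \<in> finite_rank E"
  using finite_rank.add_rank_one[OF finite_rank.zero] by fastforce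

lemma finite_rank_add: "b \<in> finite_rank E \<Longrightarrow> a \<in> finite_rank E \<Longrightarrow> a + b \<in> finite_rank E"
  by (induction rule: finite_rank.induct) (auto simp flip: add.assoc intro: finite_rank.intros)

lemma finite_rank_uminus: "a \<in> finite_rank E \<Longrightarrow> - a \<in> finite_rank E"
proof (induction rule: finite_rank.induct)
  case (add_rank_one a x y)
  then show ?case
    using finite_rank.add_rank_one[of "- a" E "- x" y] by simp
qed (simp add: finite_rank.zero)

lemma finite_rank_diff: "a \<in> finite_rank E \<Longrightarrow> b \<in> finite_rank E \<Longrightarrow> a - b \<in> finite_rank E"
  using finite_rank_add[OF finite_rank_uminus, of b E a] by simp

lemma finite_rank_mult_left: "a \<in> finite_rank E \<Longrightarrow> r * a \<in> finite_rank E"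
proof (induction rule: finite_rank.induct)
  case (add_rank_one a x y)
  then show ?case
    using finite_rank.add_rank_one[of "r * a" E "r * x" y] by (simp add: distrib_left mult.assoc)
qed (simp add: finite_rank.zero)

lemma finite_rank_mult_right: "a \<in> finite_rank E \<Longrightarrow> a * r \<in> finite_rank E"
proof (induction rule: finite_rank.induct)
  case (add_rank_one a x y)
  then show ?case
    using finite_rank.add_rank_one[of "a * r" E x "y * r"]
    by (simp add: distrib_right mult.assoc) (simp flip: mult.assoc)
qed (simp add: finite_rank.zero)

lemma finite_rank_sum: "(\<And>c. c \<in> C \<Longrightarrow> f c \<in> finite_rank E) \<Longrightarrow> sum f C \<in> finite_rank E"
  by (induction C rule: infinite_finite_induct) (auto intro: finite_rank_add finite_rank.zero)

lemma (in rank_one_ring) ureg_plus_finite_rank: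
  assumes "b \<in> finite_rank E" "a \<in> R" "ureg a"
  shows "a + b \<in> R \<and> ureg (a + b)"
  using assms
proof (induction rule: finite_rank.induct)
  case (add_rank_one b x y)
  then show ?case
    using ureg_plus_rank_one[of "a + b" x y]
    by (auto simp flip: add.assoc intro: add_mem mult_mem[OF column_mem row_mem])
qed simp

section \<open>Integer-indexed matrices vanishing below a diagonal\<close>

text \<open>All matrices of the ring in question vanish below some diagonal,
  which makes every product of them a finite sum.\<close>

typedef (overloaded) 'a umat = "{A :: 'a::zero zmatrix. \<exists>d. \<forall>i j. j < i + d \<longrightarrow> A i j = 0}"
  morphisms entry Umat
  by (rule exI[of _ "\<lambda>i j. 0"]) auto

lemma entry_Umat: "(\<And>i j. j < i + d \<Longrightarrow> A i j = 0) \<Longrightarrow> entry (Umat A) = A"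
  by (rule Umat_inverse) auto

lemma entry_bound: obtains d where "\<And>i j. j < i + d \<Longrightarrow> entry A i j = 0"
  using entry[of A] by blast

lemma umat_eqI: "(\<And>i j. entry A i j = entry B i j) \<Longrightarrow> A = B"
  by (metis entry_inject ext)

text \<open>\<open>W\<close> may exceed the band, so that several products can be written over one
  index set.\<close>

lemma Sum_any_band_product:
  fixes a b :: "int \<Rightarrow> 'a::semiring_0"
  assumes "finite W" "{l..h} \<subseteq> W" "\<And>k. k < l \<Longrightarrow> a k = 0" "\<And>k. h < k \<Longrightarrow> b k = 0"
  shows "Sum_any (\<lambda>k. a k * b k) = (\<Sum>k\<in>W. a k * b k)"
proof (rule Sum_any.expand_superset)
  have "k \<in> {l..h}" if "a k * b k \<noteq> 0" for k
    using that assms(3,4)[of k] by (cases "k < l"; cases "h < k") auto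
  then show "{k. a k * b k \<noteq> 0} \<subseteq> W"
    using assms(2) by blast
qed fact

instantiation umat :: (comm_ring_1) ring_1
begin

definition zero_umat :: "'a umat" where "0 = Umat (\<lambda>i j. 0)"
definition one_umat :: "'a umat" where "1 = Umat (\<lambda>i j. if i = j then 1 else 0)"
definition plus_umat :: "'a umat \<Rightarrow> 'a umat \<Rightarrow> 'a umat"
  where "A + B = Umat (\<lambda>i j. entry A i j + entry B i j)"
definition minus_umat :: "'a umat \<Rightarrow> 'a umat \<Rightarrow> 'a umat"
  where "A - B = Umat (\<lambda>i j. entry A i j - entry B i j)"
definition uminus_umat :: "'a umat \<Rightarrow> 'a umat"
  where "- A = Umat (\<lambda>i j. - entry A i j)"
definition times_umat :: "'a umat \<Rightarrow> 'a umat \<Rightarrow> 'a umat"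
  where "A * B = Umat (\<lambda>i j. Sum_any (\<lambda>k. entry A i k * entry B k j))"

lemma entry_zero: "entry (0 :: 'a umat) = (\<lambda>i j. 0)"
  unfolding zero_umat_def by (rule entry_Umat) auto

lemma entry_one: "entry (1 :: 'a umat) = (\<lambda>i j. if i = j then 1 else 0)"
  unfolding one_umat_def by (rule entry_Umat[of 0]) auto

lemma entry_plus: "entry (A + B :: 'a umat) = (\<lambda>i j. entry A i j + entry B i j)"
proof -
  obtain a b where "\<And>i j. j < i + a \<Longrightarrow> entry A i j = 0" "\<And>i j. j < i + b \<Longrightarrow> entry B i j = 0"
    by (metis entry_bound)
  then show ?thesis
    unfolding plus_umat_def by (intro entry_Umat[of "min a b"]) auto
qed

lemma entry_uminus: "entry (- A :: 'a umat) = (\<lambda>i j. - entry A i j)"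
proof -
  obtain a where "\<And>i j. j < i + a \<Longrightarrow> entry A i j = 0"
    by (metis entry_bound)
  then show ?thesis
    unfolding uminus_umat_def by (intro entry_Umat[of a]) auto
qed

lemma entry_minus: "entry (A - B :: 'a umat) = (\<lambda>i j. entry A i j - entry B i j)"
proof -
  obtain a b where "\<And>i j. j < i + a \<Longrightarrow> entry A i j = 0" "\<And>i j. j < i + b \<Longrightarrow> entry B i j = 0"
    by (metis entry_bound)
  then show ?thesis
    unfolding minus_umat_def by (intro entry_Umat[of "min a b"]) auto
qed

lemma entry_times: "entry (A * B :: 'a umat) = (\<lambda>i j. Sum_any (\<lambda>k. entry A i k * entry B k j))"
proof -
  obtain a b where ab: "\<And>i j. j < i + a \<Longrightarrow> entry A i j = 0" "\<And>i j. j < i + b \<Longrightarrow> entry B i j = 0"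
    by (metis entry_bound)
  show ?thesis
    unfolding times_umat_def
  proof (rule entry_Umat[of "a + b"])
    fix i j :: int assume "j < i + (a + b)"
    then have "entry A i k * entry B k j = 0" for k
      using ab(1)[of k i] ab(2)[of j k] by (cases "k < i + a") auto
    then show "Sum_any (\<lambda>k. entry A i k * entry B k j) = 0"
      by simp
  qed
qed

lemma entry_times_sum:
  fixes A B :: "'a umat"
  assumes "\<And>k. k < l \<Longrightarrow> entry A i k = 0" "\<And>k. h < k \<Longrightarrow> entry B k j = 0" "finite W" "{l..h} \<subseteq> W"
  shows "entry (A * B) i j = (\<Sum>k\<in>W. entry A i k * entry B k j)"
  unfolding entry_times using assms by (intro Sum_any_band_product) auto

instance
proof
  fix A B C :: "'a umat"
  obtain a b c where
    a: "\<And>i j. j < i + a \<Longrightarrow> entry A i j = 0" and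
    b: "\<And>i j. j < i + b \<Longrightarrow> entry B i j = 0" and
    c: "\<And>i j. j < i + c \<Longrightarrow> entry C i j = 0"
    by (metis entry_bound)
  note bounds = a b c
  show "A * B * C = A * (B * C)"
  proof (rule umat_eqI)
    fix i j
    \<comment> \<open>\<open>entry B k l\<close> vanishes unless \<open>k + b \<le> l\<close>, which
      turns the bounds \<open>i + a \<le> k\<close> and \<open>l \<le> j - c\<close> into a fixed
      rectangle for both indices; a plain exchange of finite sums then suffices.\<close>
    let ?K = "{i + a..j - b - c}" and ?L = "{i + a + b..j - c}"
    have AB: "entry (A * B) i l = (\<Sum>k\<in>?K. entry A i k * entry B k l)" if "l \<in> ?L" for l
      using that by (intro entry_times_sum[of "i + a" _ _ "l - b"]) (auto intro: bounds)
    have BC: "entry (B * C) k j = (\<Sum>l\<in>?L. entry B k l * entry C l j)" if "k \<in> ?K" for k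
      using that by (intro entry_times_sum[of "k + b" _ _ "j - c"]) (auto intro: bounds)
    have AB0: "entry (A * B) i l = 0" if "l < i + a + b" for l
      using that by (subst entry_times_sum[of "i + a" _ _ "l - b" _ _ "{}"]) (auto intro: bounds)
    have BC0: "entry (B * C) k j = 0" if "j - b - c < k" for k
      using that by (subst entry_times_sum[of "k + b" _ _ "j - c" _ _ "{}"]) (auto intro: bounds)
    have "entry (A * B * C) i j = (\<Sum>l\<in>?L. entry (A * B) i l * entry C l j)"
      by (rule entry_times_sum[of "i + a + b" _ _ "j - c"]) (auto intro: bounds AB0)
    also have "\<dots> = (\<Sum>l\<in>?L. \<Sum>k\<in>?K. entry A i k * entry B k l * entry C l j)"
      by (intro sum.cong refl) (simp add: AB sum_distrib_right)
    also have "\<dots> = (\<Sum>k\<in>?K. \<Sum>l\<in>?L. entry A i k * entry B k l * entry C l j)"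
      by (rule sum.swap)
    also have "\<dots> = (\<Sum>k\<in>?K. entry A i k * entry (B * C) k j)"
      by (intro sum.cong refl) (simp add: BC sum_distrib_left mult.assoc)
    also have "\<dots> = entry (A * (B * C)) i j"
      by (rule entry_times_sum[of "i + a" _ _ "j - b - c", symmetric]) (auto intro: bounds BC0)
    finally show "entry (A * B * C) i j = entry (A * (B * C)) i j" .
  qed
  show "(A + B) * C = A * C + B * C"
  proof (rule umat_eqI)
    fix i j
    let ?W = "{min (i + a) (i + b)..j - c}"
    have "entry (A * C) i j = (\<Sum>k\<in>?W. entry A i k * entry C k j)"
      by (rule entry_times_sum[of "i + a" _ _ "j - c"]) (auto intro: bounds)
    moreover have "entry (B * C) i j = (\<Sum>k\<in>?W. entry B i k * entry C k j)"
      by (rule entry_times_sum[of "i + b" _ _ "j - c"]) (auto intro: bounds)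
    moreover have "entry ((A + B) * C) i j = (\<Sum>k\<in>?W. entry (A + B) i k * entry C k j)"
      by (rule entry_times_sum[of "min (i + a) (i + b)" _ _ "j - c"]) (auto simp: entry_plus bounds)
    ultimately show "entry ((A + B) * C) i j = entry (A * C + B * C) i j"
      by (simp add: entry_plus distrib_right sum.distrib)
  qed
  show "A * (B + C) = A * B + A * C"
  proof (rule umat_eqI)
    fix i j
    let ?W = "{i + a..max (j - b) (j - c)}"
    have "entry (A * B) i j = (\<Sum>k\<in>?W. entry A i k * entry B k j)"
      by (rule entry_times_sum[of "i + a" _ _ "j - b"]) (auto intro: bounds)
    moreover have "entry (A * C) i j = (\<Sum>k\<in>?W. entry A i k * entry C k j)"
      by (rule entry_times_sum[of "i + a" _ _ "j - c"]) (auto intro: bounds)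
    moreover have "entry (A * (B + C)) i j = (\<Sum>k\<in>?W. entry A i k * entry (B + C) k j)"
      by (rule entry_times_sum[of "i + a" _ _ "max (j - b) (j - c)"]) (auto simp: entry_plus bounds)
    ultimately show "entry (A * (B + C)) i j = entry (A * B + A * C) i j"
      by (simp add: entry_plus distrib_left sum.distrib)
  qed
  show "1 * A = A"
  proof (rule umat_eqI)
    fix i j
    have "entry (1 * A) i j = (\<Sum>k\<in>{i..max i (j - a)}. entry 1 i k * entry A k j)"
      by (rule entry_times_sum[of i _ _ "j - a"]) (auto intro: bounds simp: entry_one)
    then show "entry (1 * A) i j = entry A i j"
      by (simp add: entry_one if_distrib[where f = "\<lambda>x. x * _"] cong: if_cong)
  qed
  show "A * 1 = A"
  proof (rule umat_eqI)
    fix i j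
    have "entry (A * 1) i j = (\<Sum>k\<in>{min j (i + a)..j}. entry A i k * entry 1 k j)"
      by (rule entry_times_sum[of "i + a" _ _ j]) (auto intro: bounds simp: entry_one)
    then show "entry (A * 1) i j = entry A i j"
      by (simp add: entry_one if_distrib[where f = "\<lambda>x. _ * x"] cong: if_cong)
  qed
  have "entry 0 0 0 \<noteq> entry (1 :: 'a umat) 0 0"
    by (simp add: entry_zero entry_one)
  then show "(0 :: 'a umat) \<noteq> 1" by metis
qed (auto intro!: umat_eqI simp: entry_plus entry_minus entry_uminus entry_zero)

end

section \<open>Diagonal projections, rank-one matrices and finite-rank corners\<close>

definition proj :: "int set \<Rightarrow> 'a::comm_ring_1 umat"
  where "proj S = Umat (\<lambda>i j. if i = j \<and> i \<in> S then 1 else 0)"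

lemma entry_proj: "entry (proj S) = (\<lambda>i j. if i = j \<and> i \<in> S then 1 else 0)"
  unfolding proj_def by (rule entry_Umat[of 0]) auto

lemma entry_proj_times: "entry (proj S * A) i j = (if i \<in> S then entry A i j else 0)"
proof -
  obtain a where a: "\<And>i j. j < i + a \<Longrightarrow> entry A i j = 0"
    by (metis entry_bound)
  have "entry (proj S * A) i j = (\<Sum>k\<in>{i..max i (j - a)}. entry (proj S) i k * entry A k j)"
    by (rule entry_times_sum[of i _ _ "j - a"]) (auto intro: a simp: entry_proj)
  also have "\<dots> = (\<Sum>k\<in>{i..max i (j - a)}. if k = i then (if i \<in> S then entry A i j else 0) else 0)"
    by (rule sum.cong) (auto simp: entry_proj)
  finally show ?thesis by simp
qed

lemma entry_times_proj: "entry (A * proj S) i j = (if j \<in> S then entry A i j else 0)"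
proof -
  obtain a where a: "\<And>i j. j < i + a \<Longrightarrow> entry A i j = 0"
    by (metis entry_bound)
  have "entry (A * proj S) i j = (\<Sum>k\<in>{min j (i + a)..j}. entry A i k * entry (proj S) k j)"
    by (rule entry_times_sum[of "i + a" _ _ j]) (auto intro: a simp: entry_proj)
  also have "\<dots> = (\<Sum>k\<in>{min j (i + a)..j}. if k = j then (if j \<in> S then entry A i j else 0) else 0)"
    by (rule sum.cong) (auto simp: entry_proj)
  finally show ?thesis by simp
qed

lemma proj_mult: "proj S * proj T = proj (S \<inter> T)"
  by (rule umat_eqI) (auto simp: entry_proj_times entry_proj)

text \<open>The projection \<open>E\<close> of the abstract part; the index 0 is an arbitrary
  choice. Vectors are stored in column 0 and functionals in row 0.\<close>

abbreviation unit00 :: "'a::comm_ring_1 umat"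
  where "unit00 \<equiv> proj {0}"

lemma column_iff: "x * unit00 = x \<longleftrightarrow> (\<forall>i j. j \<noteq> 0 \<longrightarrow> entry x i j = 0)"
proof -
  have "x * unit00 = x \<longleftrightarrow> (\<forall>i j. entry (x * unit00) i j = entry x i j)"
    by (metis umat_eqI)
  then show ?thesis by (auto simp: entry_times_proj)
qed

lemma row_iff: "unit00 * y = y \<longleftrightarrow> (\<forall>i j. i \<noteq> 0 \<longrightarrow> entry y i j = 0)"
proof -
  have "unit00 * y = y \<longleftrightarrow> (\<forall>i j. entry (unit00 * y) i j = entry y i j)"
    by (metis umat_eqI)
  then show ?thesis by (auto simp: entry_proj_times)
qed

lemma entry_rank_one:
  assumes "x * unit00 = x"
  shows "entry (x * y) i j = entry x i 0 * entry y 0 j"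
proof -
  have "entry (x * y) i j = (\<Sum>k\<in>{0..0}. entry x i k * entry y k j)"
    unfolding entry_times
  proof (rule Sum_any.expand_superset)
    show "{k. entry x i k * entry y k j \<noteq> 0} \<subseteq> {0..0}"
      using assms by (auto simp: column_iff) (metis mult_zero_left)
  qed simp
  then show ?thesis by simp
qed

definition column_mat :: "(int \<Rightarrow> 'a::zero) \<Rightarrow> 'a umat"
  where "column_mat v = Umat (\<lambda>i j. if j = 0 then v i else 0)"

definition row_mat :: "(int \<Rightarrow> 'a::zero) \<Rightarrow> 'a umat"
  where "row_mat v = Umat (\<lambda>i j. if i = 0 then v j else 0)"

lemma entry_column_mat:
  "(\<And>i. i \<ge> m \<Longrightarrow> v i = 0) \<Longrightarrow> entry (column_mat v) = (\<lambda>i j. if j = 0 then v i else 0)"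
  unfolding column_mat_def by (rule entry_Umat[of "- m"]) auto

lemma entry_row_mat:
  "(\<And>j. j < n \<Longrightarrow> v j = 0) \<Longrightarrow> entry (row_mat v) = (\<lambda>i j. if i = 0 then v j else 0)"
  unfolding row_mat_def by (rule entry_Umat[of n]) auto

text \<open>The bounds \<open>m\<close> and \<open>n\<close> make the stored columns and rows vanish
  below a diagonal, so that \<open>Umat\<close> represents them faithfully.\<close>

lemma outer_sum_finite_rank:
  assumes u: "\<And>c i. i \<ge> m \<Longrightarrow> u c i = 0" and v: "\<And>c j. j < n \<Longrightarrow> v c j = 0"
    and A: "\<And>i j. entry A i j = (\<Sum>c\<in>C. u c i * v c j)"
  shows "A \<in> finite_rank unit00"
proof -
  have e1: "entry (column_mat (u c)) = (\<lambda>i j. if j = 0 then u c i else 0)" for c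
    using u by (rule entry_column_mat[where m = m and v = "u c"])
  have e2: "entry (row_mat (v c)) = (\<lambda>i j. if i = 0 then v c j else 0)" for c
    using v by (rule entry_row_mat[where n = n and v = "v c"])
  have col: "column_mat (u c) * unit00 = column_mat (u c)" for c
    by (simp add: column_iff e1)
  have row: "unit00 * row_mat (v c) = row_mat (v c)" for c
    by (simp add: row_iff e2)
  have sum_entry: "entry (\<Sum>c\<in>D. f c) i j = (\<Sum>c\<in>D. entry (f c) i j)" for D f i j
    by (induction D rule: infinite_finite_induct) (auto simp: entry_zero entry_plus)
  have "A = (\<Sum>c\<in>C. column_mat (u c) * row_mat (v c))"
    by (rule umat_eqI) (simp add: A sum_entry entry_rank_one[OF col] e1 e2)
  then show ?thesis
    by (simp add: finite_rank_sum finite_rank_rank_one col row)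
qed

lemma proj_finite_rank:
  assumes "finite S" shows "(proj S :: 'a::comm_ring_1 umat) \<in> finite_rank unit00"
proof -
  \<comment> \<open>The guard \<open>c \<in> S\<close> makes the bounds required by
    \<open>outer_sum_finite_rank\<close> hold for every \<open>c\<close>; inserting 0 below keeps
    \<open>Max\<close> and \<open>Min\<close> meaningful for empty \<open>S\<close>.\<close>
  let ?e = "\<lambda>c i. if (c::int) \<in> S \<and> i = c then 1 else (0 :: 'a)"
  define m n where "m = Max (insert 0 S) + 1" and "n = Min (insert 0 S)"
  have "s \<le> Max (insert 0 S)" "n \<le> s" if "s \<in> S" for s
    using that assms by (simp_all add: n_def)
  then have mn: "s < m" "n \<le> s" if "s \<in> S" for s
    using that by (simp_all add: m_def zless_add1_eq le_less)
  have "entry (proj S) i j = (\<Sum>c\<in>S. ?e c i * ?e c j)" for i j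
  proof -
    have "(\<Sum>c\<in>S. ?e c i * ?e c j) = (\<Sum>c\<in>S. if c = i then (if i = j then 1 else 0) else 0)"
      by (rule sum.cong) auto
    also have "\<dots> = entry (proj S) i j"
      using assms by (simp add: entry_proj)
    finally show ?thesis
      by (rule sym)
  qed
  then show ?thesis
  proof (rule outer_sum_finite_rank[where u = ?e and v = ?e and C = S and m = m and n = n, rotated 2])
    show "?e c i = 0" if "i \<ge> m" for c i
      using mn(1)[of i] that by auto
    show "?e c j = 0" if "j < n" for c j
      using mn(2)[of j] that by auto
  qed
qed

text \<open>Translates the linear-algebra condition into membership in the ideal. A finite maximal
  independent set of columns expresses all columns, and the coefficients form the row factors;
  conversely every rank-one term enlarges a finite spanning set of the columns by one
  vector.\<close>

lemma corner_finite_rank_iff: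
  "corner_finite_rank m n (entry B) \<longleftrightarrow> proj {..<m} * B * proj {n..} \<in> finite_rank unit00"
proof
  assume fr: "corner_finite_rank m n (entry B)"
  let ?A = "proj {..<m} * B * proj {n..}"
  obtain C where C: "C \<subseteq> corner_columns m n (entry B)" "col.independent C"
    "corner_columns m n (entry B) \<subseteq> col.span C"
    using col.maximal_independent_subset by blast
  then have fin: "finite C"
    using fr unfolding corner_finite_rank_def by blast
  define w where "w j = (\<lambda>i. if i < m then entry B i j else 0)" for j
  have "w j \<in> col.span C" if "j \<ge> n" for j
    using C that unfolding corner_columns_def w_def by blast
  then have "\<forall>j. j \<ge> n \<longrightarrow> (\<exists>r. w j = (\<Sum>c\<in>C. col_scale (r c) c))"
    using fin by (auto simp: col.span_finite)
  then obtain r where r: "\<And>j. j \<ge> n \<Longrightarrow> w j = (\<Sum>c\<in>C. col_scale (r j c) c)"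
    by metis
  show "?A \<in> finite_rank unit00"
  proof (rule outer_sum_finite_rank[where C = C and m = m and n = n and
        u = "\<lambda>c i. if c \<in> C then c i else 0" and v = "\<lambda>c j. if n \<le> j then r j c else 0"])
    fix i j :: int
    show "i \<ge> m \<Longrightarrow> (if c \<in> C then c i else 0) = 0" for c
      using C(1) by (auto simp: corner_columns_def)
    show "j < n \<Longrightarrow> (if n \<le> j then r j c else 0) = 0" for c
      by simp
    have "(\<Sum>c\<in>D. col_scale (r j c) c) i = (\<Sum>c\<in>D. c i * r j c)" for D
      by (induction D rule: infinite_finite_induct) (auto simp: col_scale_def mult.commute)
    then have "w j i = (\<Sum>c\<in>C. c i * r j c)" if "j \<ge> n"
      using r[OF that] by metis
    then show "entry ?A i j = (\<Sum>c\<in>C. (if c \<in> C then c i else 0) * (if n \<le> j then r j c else 0))"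
      by (cases "n \<le> j") (simp_all add: w_def entry_proj_times entry_times_proj)
  qed
next
  let ?A = "proj {..<m} * B * proj {n..}"
  assume A: "?A \<in> finite_rank unit00"
  have "\<exists>T. finite T \<and> (\<forall>j. (\<lambda>i. entry D i j) \<in> col.span T)" if "D \<in> finite_rank unit00" for D :: "'a umat"
    using that
  proof (induction rule: finite_rank.induct)
    case zero
    show ?case
      using col.span_zero[of "{}"] by (intro exI[of _ "{}"]) (simp add: entry_zero zero_fun_def)
  next
    case (add_rank_one a x y)
    then obtain T where T: "finite T" "\<And>j. (\<lambda>i. entry a i j) \<in> col.span T" by blast
    let ?v = "\<lambda>i. entry x i 0"
    have "(\<lambda>i. entry (a + x * y) i j) = (\<lambda>i. entry a i j) + col_scale (entry y 0 j) ?v" for j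
      using add_rank_one by (auto simp: entry_plus entry_rank_one col_scale_def mult.commute)
    moreover have "(\<lambda>i. entry a i j) + col_scale (entry y 0 j) ?v \<in> col.span (insert ?v T)" for j
      using T(2)[of j] col.span_mono[OF subset_insertI, of T ?v]
      by (intro col.span_add col.span_scale) (auto intro: col.span_base)
    ultimately show ?case
      using T(1) by (intro exI[of _ "insert ?v T"]) simp
  qed
  then obtain T where T: "finite T" "\<And>j. (\<lambda>i. entry ?A i j) \<in> col.span T"
    using A by blast
  have "(\<lambda>i. if i < m then entry B i j else 0) = (\<lambda>i. entry ?A i j)" if "j \<ge> n" for j
    using that by (auto simp: entry_proj_times entry_times_proj)
  then have "corner_columns m n (entry B) \<subseteq> col.span T"
    using T(2) by (auto simp: corner_columns_def)
  then show "corner_finite_rank m n (entry B)"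
    using col.independent_span_bound[OF T(1)] unfolding corner_finite_rank_def by blast
qed

section \<open>Toeplitz matrices and symbols\<close>

definition toeplitz :: "'a::comm_ring_1 fls \<Rightarrow> 'a umat"
  where "toeplitz f = Umat (\<lambda>i j. fls_nth f (j - i))"

lemma entry_toeplitz: "entry (toeplitz f) = (\<lambda>i j. fls_nth f (j - i))"
  unfolding toeplitz_def by (rule entry_Umat[of "fls_subdegree f"]) auto

text \<open>The substitution \<open>k - i\<close> turns the matrix product into the Cauchy product;
  it is exact because the indices run over all integers.\<close>

lemma toeplitz_mult: "toeplitz (f * g) = toeplitz f * toeplitz g"
proof (rule umat_eqI)
  fix i j
  let ?df = "fls_subdegree f" and ?dg = "fls_subdegree g"
  have "entry (toeplitz f * toeplitz g) i j =
      (\<Sum>k\<in>{i + ?df..j - ?dg}. entry (toeplitz f) i k * entry (toeplitz g) k j)"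
    by (rule entry_times_sum[of "i + ?df" _ _ "j - ?dg"]) (auto simp: entry_toeplitz)
  also have "\<dots> = (\<Sum>k\<in>{?df..j - i - ?dg}. fls_nth f k * fls_nth g (j - i - k))"
    by (rule sum.reindex_bij_witness[of _ "\<lambda>k. k + i" "\<lambda>k. k - i"])
       (auto simp: entry_toeplitz algebra_simps)
  finally show "entry (toeplitz (f * g)) i j = entry (toeplitz f * toeplitz g) i j"
    by (simp add: entry_toeplitz fls_times_nth(2))
qed

lemma toeplitz_one: "toeplitz 1 = 1"
  by (rule umat_eqI) (auto simp: entry_toeplitz entry_one)

abbreviation pos :: "'a::comm_ring_1 umat"
  where "pos \<equiv> proj {0..}"

abbreviation neg :: "'a::comm_ring_1 umat"
  where "neg \<equiv> proj {..<0}"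

lemma neg_eq: "neg = 1 - pos"
  by (rule umat_eqI) (auto simp: entry_proj entry_one entry_minus)

lemma finite_rows_finite_rank:
  assumes "finite S" "\<And>i j. i \<notin> S \<Longrightarrow> entry A i j = 0"
  shows "A \<in> finite_rank unit00"
proof -
  have "A = proj S * A"
    by (rule umat_eqI) (auto simp: entry_proj_times assms(2))
  then show ?thesis
    using finite_rank_mult_right[OF proj_finite_rank[OF assms(1)]] by metis
qed

text \<open>For \<open>j < 0 \<le> i\<close> the degree \<open>j - i\<close> is negative, so only
  the finitely many polar terms of \<open>f\<close> occur.\<close>

lemma pos_toeplitz_neg: "pos * toeplitz f * neg \<in> finite_rank unit00"
  by (rule finite_rows_finite_rank[of "{0..- fls_subdegree f}"])
     (auto simp: entry_proj_times entry_times_proj entry_toeplitz)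

text \<open>A Toeplitz matrix need not lie in the ring, since its corner is a Hankel matrix, which has
  finite rank only for rational series. Erasing the corner repairs this, and is multiplicative
  modulo finite rank.\<close>

definition lift_fls :: "'a::comm_ring_1 fls \<Rightarrow> 'a umat"
  where "lift_fls f = toeplitz f - neg * toeplitz f * pos"

lemma entry_lift_fls:
  "entry (lift_fls f) i j = (if i < 0 \<and> j \<ge> 0 then 0 else fls_nth f (j - i))"
  by (auto simp: lift_fls_def entry_minus entry_proj_times entry_times_proj entry_toeplitz)

lemma lift_fls_one: "lift_fls 1 = 1"
  by (rule umat_eqI) (auto simp: entry_lift_fls entry_one)

lemma lift_fls_zero: "lift_fls 0 = 0"
  by (rule umat_eqI) (auto simp: entry_lift_fls entry_zero)

lemma lift_fls_diff: "lift_fls (f - g) = lift_fls f - lift_fls g"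
  by (rule umat_eqI) (auto simp: entry_lift_fls entry_minus)

text \<open>In blocks along \<open>neg\<close> and \<open>pos\<close> the discrepancy lies on the
  diagonal: in each term one factor runs through the erased corner and the other is
  \<open>pos * toeplitz _ * neg\<close>. The latter has finite rank and vanishes for power
  series.\<close>

lemma lift_fls_mult:
  "lift_fls (f * g) = lift_fls f * lift_fls g
     + (neg * toeplitz f * (pos * toeplitz g * neg) + pos * toeplitz f * neg * toeplitz g * pos)"
proof -
  have pp: "pos * pos = pos" "pos * (pos * A) = pos * A" for A :: "'a umat"
    by (simp_all add: proj_mult flip: mult.assoc)
  show ?thesis
    unfolding lift_fls_def toeplitz_mult neg_eq by (simp add: algebra_simps pp)
qed

section \<open>The ring as symbols modulo finite rank\<close>

text \<open>The image under \<open>entry\<close> is \<open>laurent_zmatrices\<close>. Describing the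
  matrices by a symbol modulo the ideal makes closure under the operations pure algebra, with no
  corner to track.\<close>

definition laurent_umats :: "'a::comm_ring_1 umat set"
  where "laurent_umats = {A. \<exists>f. A - lift_fls f \<in> finite_rank unit00}"

lemma finite_rank_laurent: "A \<in> finite_rank unit00 \<Longrightarrow> A \<in> laurent_umats"
  unfolding laurent_umats_def by (auto simp: lift_fls_zero intro!: exI[of _ 0])

lemma lift_fls_mult_finite_rank:
  "lift_fls f * lift_fls g - lift_fls (f * g) \<in> finite_rank unit00"
proof -
  have "lift_fls f * lift_fls g - lift_fls (f * g) =
     - (neg * toeplitz f * (pos * toeplitz g * neg) + pos * toeplitz f * neg * toeplitz g * pos)"
    by (simp add: lift_fls_mult)
  then show ?thesis
    using finite_rank_mult_left[OF pos_toeplitz_neg]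
      finite_rank_mult_right[OF finite_rank_mult_right[OF pos_toeplitz_neg]]
    by (simp only:) (intro finite_rank_uminus finite_rank_add)
qed

lemma symbol_mult:
  assumes "A - lift_fls f \<in> finite_rank unit00" "B - lift_fls g \<in> finite_rank unit00"
  shows "A * B - lift_fls (f * g) \<in> finite_rank unit00"
proof -
  have "A * B - lift_fls (f * g) = (A - lift_fls f) * B + lift_fls f * (B - lift_fls g)
      + (lift_fls f * lift_fls g - lift_fls (f * g))"
    by (simp add: algebra_simps)
  then show ?thesis
    using assms lift_fls_mult_finite_rank
    by (metis finite_rank_add finite_rank_mult_left finite_rank_mult_right)
qed

lemma laurent_umats_mult: "A \<in> laurent_umats \<Longrightarrow> B \<in> laurent_umats \<Longrightarrow> A * B \<in> laurent_umats"
  unfolding laurent_umats_def using symbol_mult by blast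

lemma laurent_umats_diff:
  assumes "A \<in> laurent_umats" "B \<in> laurent_umats" shows "A - B \<in> laurent_umats"
proof -
  obtain f g where "A - lift_fls f \<in> finite_rank unit00" "B - lift_fls g \<in> finite_rank unit00"
    using assms unfolding laurent_umats_def by blast
  then have "A - B - lift_fls (f - g) \<in> finite_rank unit00"
    using finite_rank_diff[of "A - lift_fls f" unit00 "B - lift_fls g"]
    by (simp add: lift_fls_diff algebra_simps)
  then show ?thesis
    unfolding laurent_umats_def by blast
qed

lemma lift_fls_laurent: "lift_fls f \<in> laurent_umats"
  unfolding laurent_umats_def by (auto intro!: exI[of _ f] finite_rank.zero)

interpretation laurent: rank_one_ring "unit00 :: 'a::field umat" laurent_umats
proof
  have EE: "(unit00 :: 'a umat) * unit00 = unit00"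
    by (simp add: proj_mult)
  then show "(unit00 :: 'a umat) * unit00 = unit00" .
  fix x :: "'a umat"
  \<comment> \<open>Such an \<open>x\<close> equals \<open>x * unit00\<close>, a rank-one
    product.\<close>
  show "x \<in> laurent_umats" if "x * unit00 = x"
    using finite_rank_rank_one[OF that EE] that by (simp add: finite_rank_laurent)
  show "x \<in> laurent_umats" if "unit00 * x = x"
    using finite_rank_rank_one[OF EE that] that by (simp add: finite_rank_laurent)
  show "\<exists>z. unit00 * z = z \<and> z * x = unit00" if x: "x * unit00 = x" "x \<noteq> 0"
  proof -
    obtain k j where "entry x k j \<noteq> 0"
      using x(2) by (metis umat_eqI entry_zero)
    then have k: "entry x k 0 \<noteq> 0"
      using x(1) by (metis column_iff)
    define z where "z = row_mat (\<lambda>j. if j = k then inverse (entry x k 0) else 0)"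
    have z: "entry z i j = (if i = 0 \<and> j = k then inverse (entry x k 0) else 0)" for i j
      unfolding z_def by (subst entry_row_mat[of k]) auto
    have "entry (z * x) i j = (\<Sum>l\<in>{k}. entry z i l * entry x l j)" for i j
      unfolding entry_times by (rule Sum_any.expand_superset) (auto simp: z)
    then have "z * x = unit00"
      using k x(1) by (intro umat_eqI) (auto simp: z entry_proj column_iff)
    moreover have "unit00 * z = z"
      by (simp add: row_iff z)
    ultimately show ?thesis by blast
  qed
  show "\<exists>w. w * unit00 = w \<and> x * w = unit00" if x: "unit00 * x = x" "x \<noteq> 0"
  proof -
    obtain i k where "entry x i k \<noteq> 0"
      using x(2) by (metis umat_eqI entry_zero)
    then have k: "entry x 0 k \<noteq> 0"
      using x(1) by (metis row_iff)
    define w where "w = column_mat (\<lambda>i. if i = k then inverse (entry x 0 k) else 0)"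
    have w: "entry w i j = (if j = 0 \<and> i = k then inverse (entry x 0 k) else 0)" for i j
      unfolding w_def by (subst entry_column_mat[of "k + 1"]) auto
    have "entry (x * w) i j = (\<Sum>l\<in>{k}. entry x i l * entry w l j)" for i j
      unfolding entry_times by (rule Sum_any.expand_superset) (auto simp: w)
    then have "x * w = unit00"
      using k x(1) by (intro umat_eqI) (auto simp: w entry_proj row_iff)
    moreover have "w * unit00 = w"
      by (simp add: column_iff w)
    ultimately show ?thesis by blast
  qed
  show "(1 :: 'a umat) \<in> laurent_umats"
    using lift_fls_laurent[of 1] by (simp add: lift_fls_one)
qed (auto intro: laurent_umats_diff laurent_umats_mult)

text \<open>Only the rows from \<open>- s\<close> to \<open>-1\<close> meet the erased corner. So
  the full shift, invertible over all integers, has the same symbol as its lift; for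
  \<open>s > 0\<close> the lift itself is singular, because these rows vanish in it.\<close>

lemma toeplitz_shift:
  "toeplitz (fls_X_intpow s) - lift_fls (fls_X_intpow s) \<in> finite_rank unit00"
  by (rule finite_rows_finite_rank[of "{- s..<0}"])
     (auto simp: entry_minus entry_lift_fls entry_toeplitz)

lemma lift_fls_mult_power_series:
  assumes "fls_subdegree f \<ge> 0" "fls_subdegree g \<ge> 0"
  shows "lift_fls f * lift_fls g = lift_fls (f * g)"
proof -
  have "pos * toeplitz h * neg = 0" if "fls_subdegree h \<ge> 0" for h :: "'a fls"
    using that by (intro umat_eqI) (auto simp: entry_proj_times entry_times_proj entry_toeplitz entry_zero)
  then show ?thesis
    using assms by (simp add: lift_fls_mult)
qed

lemma unit_with_symbol:
  fixes f :: "'a::field fls"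
  assumes "f \<noteq> 0"
  obtains u where "u \<in> laurent.units" "u - lift_fls f \<in> finite_rank unit00"
proof -
  define s where "s = fls_subdegree f"
  \<comment> \<open>Dividing out the leading power of \<open>t\<close> leaves a power series whose
    inverse is again a power series, so \<open>lift_fls\<close> multiplies the two exactly.\<close>
  define g where "g = fls_base_factor f"
  have g: "g \<noteq> 0" "fls_subdegree g = 0" "fls_subdegree (inverse g) = 0"
    using assms unfolding g_def by (simp_all del: fls_base_factor_def)
  have f: "f = fls_X_intpow s * g"
    by (simp add: g_def s_def fls_X_intpow_times_conv_shift)
  have shift_mem: "toeplitz (fls_X_intpow k) \<in> (laurent_umats :: 'a umat set)" for k
    using toeplitz_shift unfolding laurent_umats_def by blast
  have X: "(fls_X_intpow s :: 'a fls) * fls_X_intpow (- s) = 1"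
    by (simp add: fls_X_intpow_times_conv_shift)
  have "toeplitz (fls_X_intpow s :: 'a fls) \<in> laurent.units"
    using X by (intro laurent.unitsI[of _ "toeplitz (fls_X_intpow (- s))"] shift_mem)
      (simp_all add: toeplitz_one mult.commute flip: toeplitz_mult)
  moreover have "lift_fls g \<in> laurent.units"
    using g by (intro laurent.unitsI[of _ "lift_fls (inverse g)"] lift_fls_laurent)
      (simp_all add: lift_fls_mult_power_series lift_fls_one)
  ultimately have "toeplitz (fls_X_intpow s) * lift_fls g \<in> laurent.units"
    by (rule laurent.units_mult)
  moreover have "toeplitz (fls_X_intpow s) * lift_fls g - lift_fls f \<in> finite_rank unit00"
    unfolding f by (intro symbol_mult toeplitz_shift) (simp add: finite_rank.zero)
  ultimately show thesis
    using that by blast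
qed

lemma laurent_ureg:
  fixes A :: "'a::field umat"
  assumes "A \<in> laurent_umats" shows "laurent.ureg A"
proof -
  obtain f where f: "A - lift_fls f \<in> finite_rank unit00"
    using assms unfolding laurent_umats_def by blast
  show ?thesis
  proof (cases "f = 0")
    case True
    then show ?thesis
      using f laurent.ureg_plus_finite_rank[of A 0] laurent.ureg_idempotent[of 0]
      by (simp add: lift_fls_zero finite_rank_laurent finite_rank.zero)
  next
    case False
    then obtain u where u: "u \<in> laurent.units" "u - lift_fls (inverse f) \<in> finite_rank unit00"
      using unit_with_symbol[of "inverse f"] by auto
    have "u * A - 1 \<in> finite_rank unit00"
      using symbol_mult[OF u(2) f] False by (simp add: lift_fls_one)
    then have "laurent.ureg (u * A)"
      using laurent.ureg_plus_finite_rank[OF _ laurent.one_mem laurent.ureg_idempotent] by fastforce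
    then show ?thesis
      using laurent.ureg_unit_left u(1) by blast
  qed
qed

section \<open>Comparison with the definition by corners\<close>

text \<open>Column 0 of a \<open>umat\<close> vanishes for large row indices and row 0 for small
  column indices, so a rank-one product is confined to one corner.\<close>

lemma finite_rank_support:
  "A \<in> finite_rank unit00 \<Longrightarrow> \<exists>m n. \<forall>i j. i \<ge> m \<or> j < n \<longrightarrow> entry A i j = 0"
proof (induction rule: finite_rank.induct)
  case zero
  then show ?case by (simp add: entry_zero)
next
  case (add_rank_one A x y)
  then obtain m n where mn: "\<And>i j. i \<ge> m \<or> j < n \<Longrightarrow> entry A i j = 0" by blast
  obtain c d where cd: "\<And>i j. j < i + c \<Longrightarrow> entry x i j = 0" "\<And>i j. j < i + d \<Longrightarrow> entry y i j = 0"
    by (metis entry_bound)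
  have "entry (A + x * y) i j = 0" if "i \<ge> max m (1 - c) \<or> j < min n d" for i j
    using that add_rank_one.hyps by (auto simp: entry_plus entry_rank_one mn cd)
  then show ?case by blast
qed

lemma proj_diff_finite_rank:
  assumes "finite (S - T)" "finite (T - S)"
  shows "proj S - proj T \<in> finite_rank unit00"
proof -
  have "proj S - proj T = (proj (S - T) - proj (T - S) :: 'a umat)"
    by (rule umat_eqI) (auto simp: entry_minus entry_proj)
  then show ?thesis
    using assms finite_rank_diff proj_finite_rank by metis
qed

text \<open>Moving the corner changes each projection in finitely many diagonal places only, hence
  the block cut out of any \<open>A\<close> by finite rank.\<close>

lemma corner_change:
  "proj {..<m} * A * proj {n..} - neg * A * pos \<in> finite_rank unit00"
proof -
  have "{..<m} - {..<0} \<subseteq> {0..<m}" "{..<0} - {..<m} \<subseteq> {m..<0}"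
    "{n..} - {0..} \<subseteq> {n..<0}" "{0..} - {n..} \<subseteq> {0..<n}"
    by auto
  then have "proj {..<m} - neg \<in> finite_rank unit00" "proj {n..} - pos \<in> finite_rank unit00"
    by (intro proj_diff_finite_rank; meson finite_subset finite_atLeastLessThan_int)+
  then have "(proj {..<m} - neg) * (A * proj {n..}) + neg * A * (proj {n..} - pos) \<in> finite_rank unit00"
    by (intro finite_rank_add finite_rank_mult_left finite_rank_mult_right)
  then show ?thesis
    by (simp add: algebra_simps)
qed

lemma entry_laurent_umats: "entry ` laurent_umats = (laurent_zmatrices :: 'a::field zmatrix set)"
proof (intro subset_antisym subsetI)
  fix A :: "'a zmatrix" assume "A \<in> entry ` laurent_umats"
  then obtain B f where B: "A = entry B" "B - lift_fls f \<in> finite_rank unit00"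
    unfolding laurent_umats_def by blast
  obtain m' n' where mn': "\<And>i j. i \<ge> m' \<or> j < n' \<Longrightarrow> entry (B - lift_fls f) i j = 0"
    using finite_rank_support[OF B(2)] by blast
  \<comment> \<open>\<open>m \<ge> 0\<close> and \<open>n \<le> 0\<close> ensure that the corner
    erased by \<open>lift_fls\<close> lies inside the new one.\<close>
  define m n where "m = max m' 0" and "n = min n' 0"
  have "entry B i j = fls_nth f (j - i)" if "i \<ge> m \<or> j < n" for i j
    using mn'[of i j] that by (auto simp: entry_minus entry_lift_fls m_def n_def)
  moreover have "corner_finite_rank m n (entry B)"
  proof -
    have "neg * lift_fls f * pos = (0 :: 'a umat)"
      by (rule umat_eqI) (auto simp: entry_proj_times entry_times_proj entry_lift_fls entry_zero)
    then have "proj {..<m} * lift_fls f * proj {n..} \<in> finite_rank unit00"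
      using corner_change[of m "lift_fls f" n] by simp
    moreover have "proj {..<m} * (B - lift_fls f) * proj {n..} \<in> finite_rank unit00"
      using B(2) by (intro finite_rank_mult_left finite_rank_mult_right)
    ultimately have "proj {..<m} * (B - lift_fls f) * proj {n..} + proj {..<m} * lift_fls f * proj {n..}
        \<in> finite_rank unit00"
      by (rule finite_rank_add)
    then show ?thesis
      by (simp add: corner_finite_rank_iff algebra_simps)
  qed
  ultimately show "A \<in> laurent_zmatrices"
    unfolding laurent_zmatrices_def B(1) by blast
next
  fix A :: "'a zmatrix" assume "A \<in> laurent_zmatrices"
  then obtain m n f where f: "\<And>i j. i \<ge> m \<or> j < n \<Longrightarrow> A i j = fls_nth f (j - i)"
    and fr: "corner_finite_rank m n A"
    unfolding laurent_zmatrices_def by blast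
  \<comment> \<open>Outside the corner the subdegree bounds the support; inside it,
    \<open>i < m\<close> and \<open>j \<ge> n\<close> force \<open>j - i > n - m\<close>.\<close>
  have "A i j = 0" if "j < i + min (fls_subdegree f) (n - m)" for i j
    using that f[of i j] by (cases "i \<ge> m \<or> j < n") auto
  then obtain B where B: "A = entry B"
    using entry_Umat by metis
  have "proj {..<m} * B * proj {n..} \<in> finite_rank unit00"
    using fr unfolding B corner_finite_rank_iff .
  \<comment> \<open>Outside the corner \<open>B\<close> is the Toeplitz matrix, so
    \<open>B - toeplitz f\<close> is the difference of two corners. That of
    \<open>toeplitz f\<close> may have infinite rank, but it differs only by finite rank from the
    one erased in \<open>lift_fls f\<close>.\<close>
  then have "proj {..<m} * B * proj {n..}
      - (proj {..<m} * toeplitz f * proj {n..} - neg * toeplitz f * pos) \<in> finite_rank unit00"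
    using corner_change by (rule finite_rank_diff)
  also have "proj {..<m} * B * proj {n..}
      - (proj {..<m} * toeplitz f * proj {n..} - neg * toeplitz f * pos) = B - lift_fls f"
    using f by (intro umat_eqI)
      (auto simp: B lift_fls_def entry_minus entry_proj_times entry_times_proj entry_toeplitz)
  finally show "A \<in> entry ` laurent_umats"
    unfolding laurent_umats_def B by blast
qed

section \<open>Transfer to the ring record\<close>

lemma laurent_zmatrix_ring_ops:
  "carrier (laurent_zmatrix_ring :: 'a::field zmatrix ring) = entry ` laurent_umats"
  "entry A \<otimes>\<^bsub>laurent_zmatrix_ring\<^esub> entry B = entry (A * B)"
  "entry A \<oplus>\<^bsub>laurent_zmatrix_ring\<^esub> entry B = entry (A + B)"
  "\<one>\<^bsub>laurent_zmatrix_ring\<^esub> = entry 1"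
  "\<zero>\<^bsub>laurent_zmatrix_ring\<^esub> = entry 0"
  by (simp_all add: laurent_zmatrix_ring_def entry_laurent_umats entry_times entry_plus entry_one entry_zero)

lemma ring_laurent_zmatrix_ring: "ring (laurent_zmatrix_ring :: 'a::field zmatrix ring)"
proof (intro ringI abelian_groupI monoidI)
  show "\<exists>y\<in>carrier laurent_zmatrix_ring. y \<oplus>\<^bsub>laurent_zmatrix_ring\<^esub> x = \<zero>\<^bsub>laurent_zmatrix_ring\<^esub>"
    if "x \<in> carrier laurent_zmatrix_ring" for x :: "'a zmatrix"
  proof -
    obtain A where A: "A \<in> laurent_umats" "x = entry A"
      using \<open>x \<in> _\<close> by (auto simp: laurent_zmatrix_ring_ops)
    then have "- A \<in> laurent_umats"
      using laurent_umats_diff[of 0 A] finite_rank_laurent[OF finite_rank.zero] by simp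
    then show ?thesis
      using A by (auto simp: laurent_zmatrix_ring_ops intro!: bexI[of _ "- A"])
  qed
qed (auto simp: laurent_zmatrix_ring_ops algebra_simps laurent.add_mem laurent.mult_mem laurent.one_mem
    finite_rank_laurent finite_rank.zero)

theorem proposition2p2:
  shows "unit_regular_ring (laurent_zmatrix_ring :: 'a::field zmatrix ring)"
  unfolding unit_regular_ring_def
proof (intro conjI ballI ring_laurent_zmatrix_ring)
  fix a :: "'a zmatrix" assume "a \<in> carrier laurent_zmatrix_ring"
  then obtain A where A: "A \<in> laurent_umats" "a = entry A"
    by (auto simp: laurent_zmatrix_ring_ops)
  obtain u where u: "u \<in> laurent.units" "A * u * A = A"
    using laurent_ureg[OF A(1)] unfolding laurent.ureg_def by blast
  have "entry u \<in> Units laurent_zmatrix_ring"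
    using u(1) unfolding laurent.units_def Units_def
    by (auto simp: laurent_zmatrix_ring_ops) metis
  moreover have "a \<otimes>\<^bsub>laurent_zmatrix_ring\<^esub> entry u \<otimes>\<^bsub>laurent_zmatrix_ring\<^esub> a = a"
    using u(2) by (simp add: A(2) laurent_zmatrix_ring_ops)
  ultimately show "unit_regular_elem laurent_zmatrix_ring a"
    unfolding unit_regular_elem_def by blast
qed

end
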